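(* Let $S$ be a semiring, $n$ a positive integer, and $M$ an $n$-generated $S$-semimodule. Then $M$ is projective if and only if there exist $\mathbf{u}_1,\ldots,\mathbf{u}_n\in S^n$, $\mathbf{u}_i=(u_{i1},\ldots,u_{in})$, such that $M\cong S\cdot\{\mathbf{u}_i\}_{i=1}^n$ and the matrix $(u_{ij})$ is a multiplicatively idempotent element of the semiring $M_n(S)$.
   Context: A semiring $\langle S,+,\cdot,0,1\rangle$: $\langle S,+,0\rangle$ is a commutative monoid, $\langle S,\cdot,1\rangle$ is a monoid, $\cdot$ distributes over $+$ from both sides, and $0\cdot a=0=a\cdot 0$ for all $a$. A (left) $S$-semimodule is a commutative monoid $\langle M,+,0\rangle$ with a scalar multiplication $S\times M\to M$ such that $(ab)x=a(bx)$, $a(x+y)=ax+ay$, $(a+b)x=ax+bx$, $0_S x=0_M=a0_M$, $1x=x$. Semimodules are left semimodules here; the version for right semimodules is the mirror image. Homomorphisms preserve sums and scalar multiplication. $M$ is $n$-generated if it is generated by a family of $n$ elements. $S\cdot\{\mathbf{u}_i\}_{i=1}^n$ is the subsemimodule of $S^n$ generated by $\mathbf{u}_1,\dots,\mathbf{u}_n$, i.e. the set of all $\sum_{i=1}^n a_i\cdot\mathbf{u}_i$ with $a_i\in S$. An $S$-semimodule $P$ is projective if for every surjective $S$-semimodule homomorphism $g:M'\to N'$ and every homomorphism $f:P\to N'$ there is a homomorphism $\bar f:P\to M'$ with $g\circ\bar f=f$. $M_n(S)$ is the semiring of $n\times n$ matrices over $S$ with componentwise sum and product $(a_{ij})\star(b_{ij})=\left(\sum_{k=1}^n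 a_{ik}b_{kj}\right)$; multiplicatively idempotent means $(u_{ij})\star(u_{ij})=(u_{ij})$. *)

theory Defs
  imports "HOL-Algebra.Module"
begin

section \<open>Semimodules over a semiring\<close>

text \<open>
  Semirings are those of the locale \<^locale>\<open>semiring\<close>; they need not be commutative and
  \<open>\<zero> = \<one>\<close> is allowed. The record of modules is reused for semimodules; its
  fields \<^const>\<open>mult\<close> and \<^const>\<open>one\<close> carry no meaning here.
\<close>

locale semimodule = S?: semiring S + M?: abelian_monoid M
  for S (structure) and M (structure) +
  assumes smult_closed [simp, intro]:
      "\<lbrakk> a \<in> carrier S; x \<in> carrier M \<rbrakk> \<Longrightarrow> a \<odot>\<^bsub>M\<^esub> x \<in> carrier M"
    and smult_assoc:
      "\<lbrakk> a \<in> carrier S; b \<in> carrier S; x \<in> carrier M \<rbrakk> \<Longrightarrow>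
        (a \<otimes> b) \<odot>\<^bsub>M\<^esub> x = a \<odot>\<^bsub>M\<^esub> (b \<odot>\<^bsub>M\<^esub> x)"
    and smult_r_distr:
      "\<lbrakk> a \<in> carrier S; x \<in> carrier M; y \<in> carrier M \<rbrakk> \<Longrightarrow>
        a \<odot>\<^bsub>M\<^esub> (x \<oplus>\<^bsub>M\<^esub> y) = a \<odot>\<^bsub>M\<^esub> x \<oplus>\<^bsub>M\<^esub> a \<odot>\<^bsub>M\<^esub> y"
    and smult_l_distr:
      "\<lbrakk> a \<in> carrier S; b \<in> carrier S; x \<in> carrier M \<rbrakk> \<Longrightarrow>
        (a \<oplus> b) \<odot>\<^bsub>M\<^esub> x = a \<odot>\<^bsub>M\<^esub> x \<oplus>\<^bsub>M\<^esub> b \<odot>\<^bsub>M\<^esub> x"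
    and smult_l_null [simp]: "x \<in> carrier M \<Longrightarrow> \<zero> \<odot>\<^bsub>M\<^esub> x = \<zero>\<^bsub>M\<^esub>"
    and smult_r_null [simp]: "a \<in> carrier S \<Longrightarrow> a \<odot>\<^bsub>M\<^esub> \<zero>\<^bsub>M\<^esub> = \<zero>\<^bsub>M\<^esub>"
    and smult_one [simp]: "x \<in> carrier M \<Longrightarrow> \<one> \<odot>\<^bsub>M\<^esub> x = x"

definition semimodule_hom ::
  "('a, 'r) ring_scheme \<Rightarrow> ('a, 'b, 'm) module_scheme \<Rightarrow> ('a, 'c, 'k) module_scheme \<Rightarrow> ('b \<Rightarrow> 'c) set"
  where "semimodule_hom S M N =
    {h \<in> carrier M \<rightarrow> carrier N.
       (\<forall>x\<in>carrier M. \<forall>y\<in>carrier M. h (x \<oplus>\<^bsub>M\<^esub> y) = h x \<oplus>\<^bsub>N\<^esub> h y) \<and>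
       (\<forall>a\<in>carrier S. \<forall>x\<in>carrier M. h (a \<odot>\<^bsub>M\<^esub> x) = a \<odot>\<^bsub>N\<^esub> h x)}"

definition semimodule_isomorphic ::
  "('a, 'r) ring_scheme \<Rightarrow> ('a, 'b, 'm) module_scheme \<Rightarrow> ('a, 'c, 'k) module_scheme \<Rightarrow> bool"
  where "semimodule_isomorphic S M N \<longleftrightarrow>
    (\<exists>h \<in> semimodule_hom S M N. bij_betw h (carrier M) (carrier N))"

definition span_family ::
  "('a, 'r) ring_scheme \<Rightarrow> ('a, 'b, 'm) module_scheme \<Rightarrow> nat \<Rightarrow> (nat \<Rightarrow> 'b) \<Rightarrow> 'b set"
  where "span_family S M n x =
    {(\<Oplus>\<^bsub>M\<^esub>i\<in>{1..n}. a i \<odot>\<^bsub>M\<^esub> x i) | a. a \<in> {1..n} \<rightarrow> carrier S}"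

definition generated_subsemimodule ::
  "('a, 'r) ring_scheme \<Rightarrow> ('a, 'b, 'm) module_scheme \<Rightarrow> nat \<Rightarrow> (nat \<Rightarrow> 'b) \<Rightarrow> ('a, 'b, 'm) module_scheme"
  where "generated_subsemimodule S M n x = M\<lparr>carrier := span_family S M n x\<rparr>"

definition n_generated :: "('a, 'r) ring_scheme \<Rightarrow> nat \<Rightarrow> ('a, 'b, 'm) module_scheme \<Rightarrow> bool"
  where "n_generated S n M \<longleftrightarrow>
    (\<exists>x \<in> {1..n} \<rightarrow> carrier M. carrier M = span_family S M n x)"

definition lifts_along ::
  "('a, 'r) ring_scheme \<Rightarrow> ('a, 'b, 'm) module_scheme \<Rightarrow>
   ('a, 'c, 'k) module_scheme \<Rightarrow> ('a, 'd, 'l) module_scheme \<Rightarrow> bool"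
  where "lifts_along S P M' N' \<longleftrightarrow>
    (\<forall>g \<in> semimodule_hom S M' N'. \<forall>f \<in> semimodule_hom S P N'.
       g ` carrier M' = carrier N' \<longrightarrow>
       (\<exists>f' \<in> semimodule_hom S P M'. \<forall>x\<in>carrier P. g (f' x) = f x))"

text \<open>
  A formula of HOL cannot quantify over the types of the elements of \<open>M'\<close> and
  \<open>N'\<close>, so the definition has to name two types. The ones chosen are large enough to contain
  the free semimodule on \<open>P\<close> and \<open>P\<close> itself, and this is no restriction:
  by lemma \<open>projective_lifts\<close> below, a projective \<open>P\<close> lifts along
  surjective homomorphisms between semimodules with elements of arbitrary types.
\<close>

definition projective :: "('a, 'r) ring_scheme \<Rightarrow> ('a, 'b, 'm) module_scheme \<Rightarrow> bool"
  where "projective S P \<longleftrightarrow>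
    (\<forall>(M' :: ('a, 'b \<Rightarrow> 'a) module) (N' :: ('a, 'b) module).
       semimodule S M' \<longrightarrow> semimodule S N' \<longrightarrow> lifts_along S P M' N')"


section \<open>Vectors and matrices\<close>

text \<open>
  Indices run over \<open>{1..n}\<close>; vectors and matrices take the value \<^const>\<open>undefined\<close> outside
  that range, so that equality of functions is equality of all entries.
\<close>

definition vec_semimodule :: "('a, 'r) ring_scheme \<Rightarrow> nat \<Rightarrow> ('a, nat \<Rightarrow> 'a) module"
  where "vec_semimodule S n =
    \<lparr>carrier = {1..n} \<rightarrow>\<^sub>E carrier S,
     mult = undefined,
     one = undefined,
     zero = (\<lambda>j\<in>{1..n}. \<zero>\<^bsub>S\<^esub>),
     add = (\<lambda>x y. \<lambda>j\<in>{1..n}. x j \<oplus>\<^bsub>S\<^esub> y j),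
     smult = (\<lambda>a x. \<lambda>j\<in>{1..n}. a \<otimes>\<^bsub>S\<^esub> x j)\<rparr>"

definition mat_semiring :: "('a, 'r) ring_scheme \<Rightarrow> nat \<Rightarrow> (nat \<Rightarrow> nat \<Rightarrow> 'a) ring"
  where "mat_semiring S n =
    \<lparr>carrier = {1..n} \<rightarrow>\<^sub>E ({1..n} \<rightarrow>\<^sub>E carrier S),
     mult = (\<lambda>A B. \<lambda>i\<in>{1..n}. \<lambda>j\<in>{1..n}. \<Oplus>\<^bsub>S\<^esub>k\<in>{1..n}. A i k \<otimes>\<^bsub>S\<^esub> B k j),
     one = (\<lambda>i\<in>{1..n}. \<lambda>j\<in>{1..n}. if i = j then \<one>\<^bsub>S\<^esub> else \<zero>\<^bsub>S\<^esub>),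
     zero = (\<lambda>i\<in>{1..n}. \<lambda>j\<in>{1..n}. \<zero>\<^bsub>S\<^esub>),
     add = (\<lambda>A B. \<lambda>i\<in>{1..n}. \<lambda>j\<in>{1..n}. A i j \<oplus>\<^bsub>S\<^esub> B i j)\<rparr>"


section \<open>Adequacy of the definitions\<close>

lemma semimodule_homD:
  assumes "h \<in> semimodule_hom S M N"
  shows "x \<in> carrier M \<Longrightarrow> h x \<in> carrier N"
    and "\<lbrakk>x \<in> carrier M; y \<in> carrier M\<rbrakk> \<Longrightarrow> h (x \<oplus>\<^bsub>M\<^esub> y) = h x \<oplus>\<^bsub>N\<^esub> h y"
    and "\<lbrakk>a \<in> carrier S; x \<in> carrier M\<rbrakk> \<Longrightarrow> h (a \<odot>\<^bsub>M\<^esub> x) = a \<odot>\<^bsub>N\<^esub> h x"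
  using assms by (auto simp: semimodule_hom_def)

lemma semimodule_homI:
  assumes "\<And>x. x \<in> carrier M \<Longrightarrow> h x \<in> carrier N"
    and "\<And>x y. \<lbrakk>x \<in> carrier M; y \<in> carrier M\<rbrakk> \<Longrightarrow> h (x \<oplus>\<^bsub>M\<^esub> y) = h x \<oplus>\<^bsub>N\<^esub> h y"
    and "\<And>a x. \<lbrakk>a \<in> carrier S; x \<in> carrier M\<rbrakk> \<Longrightarrow> h (a \<odot>\<^bsub>M\<^esub> x) = a \<odot>\<^bsub>N\<^esub> h x"
  shows "h \<in> semimodule_hom S M N"
  using assms by (auto simp: semimodule_hom_def)

lemma semimodule_hom_zero:
  assumes "semimodule S M" "semimodule S N" "h \<in> semimodule_hom S M N"
  shows "h \<zero>\<^bsub>M\<^esub> = \<zero>\<^bsub>N\<^esub>"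
proof -
  interpret M: semimodule S M by fact
  interpret N: semimodule S N by fact
  have "h (\<zero>\<^bsub>S\<^esub> \<odot>\<^bsub>M\<^esub> \<zero>\<^bsub>M\<^esub>) = \<zero>\<^bsub>S\<^esub> \<odot>\<^bsub>N\<^esub> h \<zero>\<^bsub>M\<^esub>"
    by (rule semimodule_homD(3)[OF assms(3)]) auto
  then show ?thesis
    using semimodule_homD(1)[OF assms(3)] by simp
qed

lemma semimodule_hom_finsum:
  assumes "semimodule S M" "semimodule S N" "h \<in> semimodule_hom S M N"
    and "finite A" "f \<in> A \<rightarrow> carrier M"
  shows "h (\<Oplus>\<^bsub>M\<^esub>i\<in>A. f i) = (\<Oplus>\<^bsub>N\<^esub>i\<in>A. h (f i))"
  using assms(4,5)
proof (induction A rule: finite_induct)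
  interpret M: semimodule S M by fact
  interpret N: semimodule S N by fact
  case empty
  show ?case by (simp add: semimodule_hom_zero[OF assms(1-3)])
next
  interpret M: semimodule S M by fact
  interpret N: semimodule S N by fact
  case (insert i A)
  have f: "f i \<in> carrier M" "f \<in> A \<rightarrow> carrier M"
    using insert.prems by auto
  have hf: "h (f i) \<in> carrier N" "(\<lambda>i. h (f i)) \<in> A \<rightarrow> carrier N"
    using f semimodule_homD(1)[OF assms(3)] by auto
  show ?case
    using insert f hf by (simp add: semimodule_homD(2)[OF assms(3)])
qed

lemma (in abelian_monoid) finsum_swap:
  assumes "finite A" "finite B" "\<And>i j. \<lbrakk>i \<in> A; j \<in> B\<rbrakk> \<Longrightarrow> f i j \<in> carrier G"
  shows "(\<Oplus>i\<in>A. \<Oplus>j\<in>B. f i j) = (\<Oplus>j\<in>B. \<Oplus>i\<in>A. f i j)"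
  using assms(1,3)
proof (induction A rule: finite_induct)
  case empty
  show ?case by simp
next
  case (insert a A)
  have "(\<Oplus>j\<in>B. \<Oplus>i\<in>insert a A. f i j) = (\<Oplus>j\<in>B. f a j \<oplus> (\<Oplus>i\<in>A. f i j))"
    using insert by (intro finsum_cong') (auto simp: Pi_iff)
  also have "\<dots> = (\<Oplus>j\<in>B. f a j) \<oplus> (\<Oplus>j\<in>B. \<Oplus>i\<in>A. f i j)"
    using insert by (intro finsum_addf) (auto simp: Pi_iff)
  finally show ?case
    using insert by (simp add: Pi_iff)
qed

context semimodule
begin

lemma finsum_smult_distr:
  assumes "finite A" "a \<in> carrier S" "f \<in> A \<rightarrow> carrier M"
  shows "a \<odot>\<^bsub>M\<^esub> (\<Oplus>\<^bsub>M\<^esub>i\<in>A. f i) = (\<Oplus>\<^bsub>M\<^esub>i\<in>A. a \<odot>\<^bsub>M\<^esub> f i)"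
  using assms(1,3)
proof (induction A rule: finite_induct)
  case empty
  show ?case using assms(2) by simp
next
  case (insert i A)
  then show ?case using assms(2) by (simp add: smult_r_distr Pi_iff)
qed

lemma span_family_closed:
  assumes "x \<in> {1..n} \<rightarrow> carrier M"
  shows "span_family S M n x \<subseteq> carrier M"
    and "\<zero>\<^bsub>M\<^esub> \<in> span_family S M n x"
    and "\<lbrakk>y \<in> span_family S M n x; z \<in> span_family S M n x\<rbrakk> \<Longrightarrow> y \<oplus>\<^bsub>M\<^esub> z \<in> span_family S M n x"
    and "\<lbrakk>a \<in> carrier S; y \<in> span_family S M n x\<rbrakk> \<Longrightarrow> a \<odot>\<^bsub>M\<^esub> y \<in> span_family S M n x"
proof -
  have x: "x i \<in> carrier M" if "i \<in> {1..n}" for i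
    using assms that by auto
  show "span_family S M n x \<subseteq> carrier M"
    using x by (auto simp: span_family_def Pi_iff intro!: M.finsum_closed)
  have "(\<Oplus>\<^bsub>M\<^esub>i\<in>{1..n}. \<zero> \<odot>\<^bsub>M\<^esub> x i) = (\<Oplus>\<^bsub>M\<^esub>i\<in>{1..n}. \<zero>\<^bsub>M\<^esub>)"
    using x by (intro M.finsum_cong') auto
  then have "\<zero>\<^bsub>M\<^esub> = (\<Oplus>\<^bsub>M\<^esub>i\<in>{1..n}. (\<lambda>_. \<zero>) i \<odot>\<^bsub>M\<^esub> x i)"
    by simp
  then show "\<zero>\<^bsub>M\<^esub> \<in> span_family S M n x"
    unfolding span_family_def by (intro CollectI exI[of _ "\<lambda>_. \<zero>"] conjI) auto
  show "y \<oplus>\<^bsub>M\<^esub> z \<in> span_family S M n x"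
    if "y \<in> span_family S M n x" "z \<in> span_family S M n x"
  proof -
    from that obtain a b where a: "a \<in> {1..n} \<rightarrow> carrier S" "y = (\<Oplus>\<^bsub>M\<^esub>i\<in>{1..n}. a i \<odot>\<^bsub>M\<^esub> x i)"
      and b: "b \<in> {1..n} \<rightarrow> carrier S" "z = (\<Oplus>\<^bsub>M\<^esub>i\<in>{1..n}. b i \<odot>\<^bsub>M\<^esub> x i)"
      by (auto simp: span_family_def)
    have "y \<oplus>\<^bsub>M\<^esub> z = (\<Oplus>\<^bsub>M\<^esub>i\<in>{1..n}. a i \<odot>\<^bsub>M\<^esub> x i \<oplus>\<^bsub>M\<^esub> b i \<odot>\<^bsub>M\<^esub> x i)"
      unfolding a(2) b(2) using a(1) b(1) x by (intro M.finsum_addf[symmetric]) (auto simp: Pi_iff)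
    also have "\<dots> = (\<Oplus>\<^bsub>M\<^esub>i\<in>{1..n}. (a i \<oplus> b i) \<odot>\<^bsub>M\<^esub> x i)"
      using a(1) b(1) x by (intro M.finsum_cong') (auto simp: Pi_iff smult_l_distr)
    finally show ?thesis
      unfolding span_family_def using a(1) b(1)
      by (intro CollectI exI[of _ "\<lambda>i. a i \<oplus> b i"] conjI) auto
  qed
  show "a \<odot>\<^bsub>M\<^esub> y \<in> span_family S M n x"
    if "a \<in> carrier S" "y \<in> span_family S M n x"
  proof -
    from that obtain b where b: "b \<in> {1..n} \<rightarrow> carrier S" "y = (\<Oplus>\<^bsub>M\<^esub>i\<in>{1..n}. b i \<odot>\<^bsub>M\<^esub> x i)"
      by (auto simp: span_family_def)
    have "a \<odot>\<^bsub>M\<^esub> y = (\<Oplus>\<^bsub>M\<^esub>i\<in>{1..n}. a \<odot>\<^bsub>M\<^esub> (b i \<odot>\<^bsub>M\<^esub> x i))"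
      unfolding b(2) using b(1) x that(1) by (intro finsum_smult_distr) (auto simp: Pi_iff)
    also have "\<dots> = (\<Oplus>\<^bsub>M\<^esub>i\<in>{1..n}. (a \<otimes> b i) \<odot>\<^bsub>M\<^esub> x i)"
      using b(1) x that(1) by (intro M.finsum_cong') (auto simp: Pi_iff smult_assoc)
    finally show ?thesis
      unfolding span_family_def using b(1) that(1)
      by (intro CollectI exI[of _ "\<lambda>i. a \<otimes> b i"] conjI) auto
  qed
qed

lemma semimodule_generated_subsemimodule:
  assumes "x \<in> {1..n} \<rightarrow> carrier M"
  shows "semimodule S (generated_subsemimodule S M n x)"
proof -
  note cl = span_family_closed[OF assms]
  have c: "y \<in> carrier M" if "y \<in> span_family S M n x" for y
    using cl(1) that by auto
  show ?thesis
  proof (intro semimodule.intro semimodule_axioms.intro)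
    show "semiring S" by (rule S.semiring_axioms)
    show "abelian_monoid (generated_subsemimodule S M n x)"
      by (rule abelian_monoidI)
         (auto simp: generated_subsemimodule_def cl c M.a_ac)
  qed (auto simp: generated_subsemimodule_def cl c smult_assoc smult_l_distr smult_r_distr)
qed

end

lemma semimodule_vec_semimodule:
  assumes "semiring S"
  shows "semimodule S (vec_semimodule S n)"
proof -
  interpret semiring S by fact
  show ?thesis
  proof (intro semimodule.intro semimodule_axioms.intro)
    show "semiring S" by fact
    show "abelian_monoid (vec_semimodule S n)"
      by (rule abelian_monoidI)
         (auto simp: vec_semimodule_def PiE_iff a_ac extensional_def fun_eq_iff)
  qed (auto simp: vec_semimodule_def PiE_iff m_assoc l_distr r_distr extensional_def fun_eq_iff)
qed

lemma semiring_mat_semiring: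
  fixes S (structure)
  assumes "semiring S"
  shows "semiring (mat_semiring S n)"
proof -
  interpret semiring S by fact
  let ?I = "{1..n}"
  have eqI: "A = B" if "A \<in> ?I \<rightarrow>\<^sub>E (?I \<rightarrow>\<^sub>E carrier S)" "B \<in> ?I \<rightarrow>\<^sub>E (?I \<rightarrow>\<^sub>E carrier S)"
    "\<And>i j. \<lbrakk>i \<in> ?I; j \<in> ?I\<rbrakk> \<Longrightarrow> A i j = B i j" for A B :: "nat \<Rightarrow> nat \<Rightarrow> 'a"
  proof (rule PiE_ext[OF that(1,2)])
    fix i assume "i \<in> ?I"
    then show "A i = B i"
      using that by (intro PiE_ext[of "A i" ?I "\<lambda>_. carrier S" "B i"]) (auto simp: PiE_iff)
  qed
  have ent: "A i j \<in> carrier S" if "A \<in> ?I \<rightarrow>\<^sub>E (?I \<rightarrow>\<^sub>E carrier S)" "i \<in> ?I" "j \<in> ?I" for A i j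
    using that by (auto simp: PiE_iff)
  have delta_l: "(\<Oplus>k\<in>?I. (if i = k then \<one> else \<zero>) \<otimes> f k) = f i"
    if "i \<in> ?I" "\<And>k. k \<in> ?I \<Longrightarrow> f k \<in> carrier S" for i f
  proof -
    have "(\<Oplus>k\<in>?I. (if i = k then \<one> else \<zero>) \<otimes> f k) = (\<Oplus>k\<in>?I. if i = k then f k else \<zero>)"
      using that by (intro finsum_cong') auto
    also have "\<dots> = f i"
      using that by (intro finsum_singleton) auto
    finally show ?thesis .
  qed
  have delta_r: "(\<Oplus>k\<in>?I. f k \<otimes> (if k = i then \<one> else \<zero>)) = f i"
    if "i \<in> ?I" "\<And>k. k \<in> ?I \<Longrightarrow> f k \<in> carrier S" for i f
  proof -
    have "(\<Oplus>k\<in>?I. f k \<otimes> (if k = i then \<one> else \<zero>)) = (\<Oplus>k\<in>?I. if i = k then f k else \<zero>)"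
      using that by (intro finsum_cong') auto
    also have "\<dots> = f i"
      using that by (intro finsum_singleton) auto
    finally show ?thesis .
  qed
  have assoc: "(\<Oplus>k\<in>?I. (\<Oplus>l\<in>?I. A i l \<otimes> B l k) \<otimes> C k j)
      = (\<Oplus>l\<in>?I. A i l \<otimes> (\<Oplus>k\<in>?I. B l k \<otimes> C k j))"
    if A: "A \<in> ?I \<rightarrow>\<^sub>E (?I \<rightarrow>\<^sub>E carrier S)" and B: "B \<in> ?I \<rightarrow>\<^sub>E (?I \<rightarrow>\<^sub>E carrier S)"
      and C: "C \<in> ?I \<rightarrow>\<^sub>E (?I \<rightarrow>\<^sub>E carrier S)" and i: "i \<in> ?I" and j: "j \<in> ?I" for A B C i j
  proof -
    note e = ent[OF A] ent[OF B] ent[OF C]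
    have "(\<Oplus>k\<in>?I. (\<Oplus>l\<in>?I. A i l \<otimes> B l k) \<otimes> C k j)
        = (\<Oplus>k\<in>?I. \<Oplus>l\<in>?I. A i l \<otimes> B l k \<otimes> C k j)"
      using i j e by (intro finsum_cong') (auto simp: Pi_iff finsum_ldistr)
    also have "\<dots> = (\<Oplus>l\<in>?I. \<Oplus>k\<in>?I. A i l \<otimes> B l k \<otimes> C k j)"
      using i j e by (intro finsum_swap) auto
    also have "\<dots> = (\<Oplus>l\<in>?I. \<Oplus>k\<in>?I. A i l \<otimes> (B l k \<otimes> C k j))"
      using i j e by (intro finsum_cong') (auto simp: Pi_iff m_assoc)
    also have "\<dots> = (\<Oplus>l\<in>?I. A i l \<otimes> (\<Oplus>k\<in>?I. B l k \<otimes> C k j))"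
      using i j e by (intro finsum_cong') (auto simp: Pi_iff finsum_rdistr)
    finally show ?thesis .
  qed
  have zl: "(\<Oplus>k\<in>?I. \<zero> \<otimes> f k) = \<zero>" "(\<Oplus>k\<in>?I. f k \<otimes> \<zero>) = \<zero>"
    if "\<And>k. k \<in> ?I \<Longrightarrow> f k \<in> carrier S" for f
    using that by (auto intro!: add.finprod_one_eqI)
  have dl: "(\<Oplus>k\<in>?I. (f k \<oplus> g k) \<otimes> h k) = (\<Oplus>k\<in>?I. f k \<otimes> h k) \<oplus> (\<Oplus>k\<in>?I. g k \<otimes> h k)"
    "(\<Oplus>k\<in>?I. h k \<otimes> (f k \<oplus> g k)) = (\<Oplus>k\<in>?I. h k \<otimes> f k) \<oplus> (\<Oplus>k\<in>?I. h k \<otimes> g k)"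
    if "\<And>k. k \<in> ?I \<Longrightarrow> f k \<in> carrier S" "\<And>k. k \<in> ?I \<Longrightarrow> g k \<in> carrier S"
      "\<And>k. k \<in> ?I \<Longrightarrow> h k \<in> carrier S" for f g h
  proof -
    have "(\<Oplus>k\<in>?I. (f k \<oplus> g k) \<otimes> h k) = (\<Oplus>k\<in>?I. f k \<otimes> h k \<oplus> g k \<otimes> h k)"
      using that by (intro finsum_cong') (auto simp: Pi_iff l_distr)
    then show "(\<Oplus>k\<in>?I. (f k \<oplus> g k) \<otimes> h k) = (\<Oplus>k\<in>?I. f k \<otimes> h k) \<oplus> (\<Oplus>k\<in>?I. g k \<otimes> h k)"
      using that by (simp add: Pi_iff)
    have "(\<Oplus>k\<in>?I. h k \<otimes> (f k \<oplus> g k)) = (\<Oplus>k\<in>?I. h k \<otimes> f k \<oplus> h k \<otimes> g k)"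
      using that by (intro finsum_cong') (auto simp: Pi_iff r_distr)
    then show "(\<Oplus>k\<in>?I. h k \<otimes> (f k \<oplus> g k)) = (\<Oplus>k\<in>?I. h k \<otimes> f k) \<oplus> (\<Oplus>k\<in>?I. h k \<otimes> g k)"
      using that by (simp add: Pi_iff)
  qed
  have mult_mem: "(\<lambda>i\<in>?I. \<lambda>j\<in>?I. \<Oplus>k\<in>?I. A i k \<otimes> B k j) \<in> ?I \<rightarrow>\<^sub>E (?I \<rightarrow>\<^sub>E carrier S)"
    if A: "A \<in> ?I \<rightarrow>\<^sub>E (?I \<rightarrow>\<^sub>E carrier S)" and B: "B \<in> ?I \<rightarrow>\<^sub>E (?I \<rightarrow>\<^sub>E carrier S)" for A B
    using ent[OF A] ent[OF B] by auto
  have add_mem: "(\<lambda>i\<in>?I. \<lambda>j\<in>?I. A i j \<oplus> B i j) \<in> ?I \<rightarrow>\<^sub>E (?I \<rightarrow>\<^sub>E carrier S)"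
    if A: "A \<in> ?I \<rightarrow>\<^sub>E (?I \<rightarrow>\<^sub>E carrier S)" and B: "B \<in> ?I \<rightarrow>\<^sub>E (?I \<rightarrow>\<^sub>E carrier S)" for A B
    using ent[OF A] ent[OF B] by auto
  have zero_mem: "(\<lambda>i\<in>?I. \<lambda>j\<in>?I. \<zero>) \<in> ?I \<rightarrow>\<^sub>E (?I \<rightarrow>\<^sub>E carrier S)"
    and one_mem: "(\<lambda>i\<in>?I. \<lambda>j\<in>?I. if i = j then \<one> else \<zero>) \<in> ?I \<rightarrow>\<^sub>E (?I \<rightarrow>\<^sub>E carrier S)"
    by auto
  note mem = mult_mem add_mem zero_mem one_mem
  have sum_cong: "(\<Oplus>k\<in>?I. f k) = (\<Oplus>k\<in>?I. g k)"
    if "\<And>k. k \<in> ?I \<Longrightarrow> f k = g k" "\<And>k. k \<in> ?I \<Longrightarrow> g k \<in> carrier S" for f g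
    using that by (intro finsum_cong') auto
  have M: "carrier (mat_semiring S n) = ?I \<rightarrow>\<^sub>E (?I \<rightarrow>\<^sub>E carrier S)"
    by (simp add: mat_semiring_def)
  show ?thesis
  proof (intro semiring.intro semiring_axioms.intro abelian_monoidI monoid.intro, unfold M)
    fix A B C
    assume A: "A \<in> ?I \<rightarrow>\<^sub>E (?I \<rightarrow>\<^sub>E carrier S)" and B: "B \<in> ?I \<rightarrow>\<^sub>E (?I \<rightarrow>\<^sub>E carrier S)"
      and C: "C \<in> ?I \<rightarrow>\<^sub>E (?I \<rightarrow>\<^sub>E carrier S)"
    note e = ent[OF A] ent[OF B] ent[OF C]
    show "A \<otimes>\<^bsub>mat_semiring S n\<^esub> B \<otimes>\<^bsub>mat_semiring S n\<^esub> C
        = A \<otimes>\<^bsub>mat_semiring S n\<^esub> (B \<otimes>\<^bsub>mat_semiring S n\<^esub> C)"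
    proof (rule eqI)
      fix i j assume ij: "i \<in> ?I" "j \<in> ?I"
      have "(\<Oplus>k\<in>?I. (\<lambda>j\<in>?I. \<Oplus>l\<in>?I. A i l \<otimes> B l j) k \<otimes> C k j)
          = (\<Oplus>k\<in>?I. (\<Oplus>l\<in>?I. A i l \<otimes> B l k) \<otimes> C k j)"
        using e ij by (intro sum_cong) auto
      also have "\<dots> = (\<Oplus>l\<in>?I. A i l \<otimes> (\<Oplus>k\<in>?I. B l k \<otimes> C k j))"
        by (rule assoc[OF A B C ij])
      also have "\<dots> = (\<Oplus>l\<in>?I. A i l \<otimes> (\<lambda>i\<in>?I. \<lambda>j\<in>?I. \<Oplus>k\<in>?I. B i k \<otimes> C k j) l j)"
        using e ij by (intro sum_cong) auto
      finally show "(A \<otimes>\<^bsub>mat_semiring S n\<^esub> B \<otimes>\<^bsub>mat_semiring S n\<^esub> C) i j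
          = (A \<otimes>\<^bsub>mat_semiring S n\<^esub> (B \<otimes>\<^bsub>mat_semiring S n\<^esub> C)) i j"
        using ij by (simp add: mat_semiring_def)
    qed (use A B C in \<open>auto simp only: mat_semiring_def ring.simps monoid.simps partial_object.simps intro!: mem\<close>)
    show "(A \<oplus>\<^bsub>mat_semiring S n\<^esub> B) \<otimes>\<^bsub>mat_semiring S n\<^esub> C
        = A \<otimes>\<^bsub>mat_semiring S n\<^esub> C \<oplus>\<^bsub>mat_semiring S n\<^esub> B \<otimes>\<^bsub>mat_semiring S n\<^esub> C"
    proof (rule eqI)
      fix i j assume ij: "i \<in> ?I" "j \<in> ?I"
      have "(\<Oplus>k\<in>?I. (\<lambda>j\<in>?I. A i j \<oplus> B i j) k \<otimes> C k j) = (\<Oplus>k\<in>?I. (A i k \<oplus> B i k) \<otimes> C k j)"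
        using e ij by (intro sum_cong) auto
      also have "\<dots> = (\<Oplus>k\<in>?I. A i k \<otimes> C k j) \<oplus> (\<Oplus>k\<in>?I. B i k \<otimes> C k j)"
        using e ij by (intro dl) auto
      finally show "((A \<oplus>\<^bsub>mat_semiring S n\<^esub> B) \<otimes>\<^bsub>mat_semiring S n\<^esub> C) i j
        = (A \<otimes>\<^bsub>mat_semiring S n\<^esub> C \<oplus>\<^bsub>mat_semiring S n\<^esub> B \<otimes>\<^bsub>mat_semiring S n\<^esub> C) i j"
        using ij by (simp add: mat_semiring_def)
    qed (use A B C in \<open>auto simp only: mat_semiring_def ring.simps monoid.simps partial_object.simps intro!: mem\<close>)
    show "C \<otimes>\<^bsub>mat_semiring S n\<^esub> (A \<oplus>\<^bsub>mat_semiring S n\<^esub> B)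
        = C \<otimes>\<^bsub>mat_semiring S n\<^esub> A \<oplus>\<^bsub>mat_semiring S n\<^esub> C \<otimes>\<^bsub>mat_semiring S n\<^esub> B"
    proof (rule eqI)
      fix i j assume ij: "i \<in> ?I" "j \<in> ?I"
      have "(\<Oplus>k\<in>?I. C i k \<otimes> (\<lambda>i\<in>?I. \<lambda>j\<in>?I. A i j \<oplus> B i j) k j)
          = (\<Oplus>k\<in>?I. C i k \<otimes> (A k j \<oplus> B k j))"
        using e ij by (intro sum_cong) auto
      also have "\<dots> = (\<Oplus>k\<in>?I. C i k \<otimes> A k j) \<oplus> (\<Oplus>k\<in>?I. C i k \<otimes> B k j)"
        using e ij by (intro dl) auto
      finally show "(C \<otimes>\<^bsub>mat_semiring S n\<^esub> (A \<oplus>\<^bsub>mat_semiring S n\<^esub> B)) i j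
        = (C \<otimes>\<^bsub>mat_semiring S n\<^esub> A \<oplus>\<^bsub>mat_semiring S n\<^esub> C \<otimes>\<^bsub>mat_semiring S n\<^esub> B) i j"
        using ij by (simp add: mat_semiring_def)
    qed (use A B C in \<open>auto simp only: mat_semiring_def ring.simps monoid.simps partial_object.simps intro!: mem\<close>)
    show "A \<oplus>\<^bsub>mat_semiring S n\<^esub> B \<oplus>\<^bsub>mat_semiring S n\<^esub> C
        = A \<oplus>\<^bsub>mat_semiring S n\<^esub> (B \<oplus>\<^bsub>mat_semiring S n\<^esub> C)"
      using e by (intro eqI) (auto simp: mat_semiring_def a_assoc)
  next
    fix A B
    assume A: "A \<in> ?I \<rightarrow>\<^sub>E (?I \<rightarrow>\<^sub>E carrier S)" and B: "B \<in> ?I \<rightarrow>\<^sub>E (?I \<rightarrow>\<^sub>E carrier S)"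
    note e = ent[OF A] ent[OF B]
    show "A \<oplus>\<^bsub>mat_semiring S n\<^esub> B \<in> ?I \<rightarrow>\<^sub>E (?I \<rightarrow>\<^sub>E carrier S)"
      using add_mem[OF A B] by (simp add: mat_semiring_def)
    show "A \<otimes>\<^bsub>mat_semiring S n\<^esub> B \<in> ?I \<rightarrow>\<^sub>E (?I \<rightarrow>\<^sub>E carrier S)"
      using mult_mem[OF A B] by (simp add: mat_semiring_def)
    show "A \<oplus>\<^bsub>mat_semiring S n\<^esub> B = B \<oplus>\<^bsub>mat_semiring S n\<^esub> A"
      using e by (intro eqI) (auto simp: mat_semiring_def a_comm)
  next
    fix A assume A: "A \<in> ?I \<rightarrow>\<^sub>E (?I \<rightarrow>\<^sub>E carrier S)"
    note e = ent[OF A]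
    show "\<zero>\<^bsub>mat_semiring S n\<^esub> \<oplus>\<^bsub>mat_semiring S n\<^esub> A = A"
      using A e by (intro eqI) (auto simp: mat_semiring_def)
    show "\<one>\<^bsub>mat_semiring S n\<^esub> \<otimes>\<^bsub>mat_semiring S n\<^esub> A = A"
    proof (rule eqI[OF _ A])
      fix i j assume ij: "i \<in> ?I" "j \<in> ?I"
      have "(\<Oplus>k\<in>?I. (\<lambda>j\<in>?I. if i = j then \<one> else \<zero>) k \<otimes> A k j)
          = (\<Oplus>k\<in>?I. (if i = k then \<one> else \<zero>) \<otimes> A k j)"
        using e ij by (intro sum_cong) auto
      also have "\<dots> = A i j"
        using e ij by (intro delta_l) auto
      finally show "(\<one>\<^bsub>mat_semiring S n\<^esub> \<otimes>\<^bsub>mat_semiring S n\<^esub> A) i j = A i j"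
        using ij by (simp add: mat_semiring_def)
    qed (use A in \<open>auto simp only: mat_semiring_def ring.simps monoid.simps partial_object.simps intro!: mem\<close>)
    show "A \<otimes>\<^bsub>mat_semiring S n\<^esub> \<one>\<^bsub>mat_semiring S n\<^esub> = A"
    proof (rule eqI[OF _ A])
      fix i j assume ij: "i \<in> ?I" "j \<in> ?I"
      have "(\<Oplus>k\<in>?I. A i k \<otimes> (\<lambda>i\<in>?I. \<lambda>j\<in>?I. if i = j then \<one> else \<zero>) k j)
          = (\<Oplus>k\<in>?I. A i k \<otimes> (if k = j then \<one> else \<zero>))"
        using e ij by (intro sum_cong) auto
      also have "\<dots> = A i j"
        using e ij by (intro delta_r) auto
      finally show "(A \<otimes>\<^bsub>mat_semiring S n\<^esub> \<one>\<^bsub>mat_semiring S n\<^esub>) i j = A i j"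
        using ij by (simp add: mat_semiring_def)
    qed (use A in \<open>auto simp only: mat_semiring_def ring.simps monoid.simps partial_object.simps intro!: mem\<close>)
    show "\<zero>\<^bsub>mat_semiring S n\<^esub> \<otimes>\<^bsub>mat_semiring S n\<^esub> A = \<zero>\<^bsub>mat_semiring S n\<^esub>"
    proof (rule eqI)
      fix i j assume ij: "i \<in> ?I" "j \<in> ?I"
      have "(\<Oplus>k\<in>?I. (\<lambda>j\<in>?I. \<zero>) k \<otimes> A k j) = (\<Oplus>k\<in>?I. \<zero> \<otimes> A k j)"
        using e ij by (intro sum_cong) auto
      also have "\<dots> = \<zero>"
        using e ij by (intro zl) auto
      finally show "(\<zero>\<^bsub>mat_semiring S n\<^esub> \<otimes>\<^bsub>mat_semiring S n\<^esub> A) i j = \<zero>\<^bsub>mat_semiring S n\<^esub> i j"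
        using ij by (simp add: mat_semiring_def)
    qed (use A in \<open>auto simp only: mat_semiring_def ring.simps monoid.simps partial_object.simps intro!: mem\<close>)
    show "A \<otimes>\<^bsub>mat_semiring S n\<^esub> \<zero>\<^bsub>mat_semiring S n\<^esub> = \<zero>\<^bsub>mat_semiring S n\<^esub>"
    proof (rule eqI)
      fix i j assume ij: "i \<in> ?I" "j \<in> ?I"
      have "(\<Oplus>k\<in>?I. A i k \<otimes> (\<lambda>i\<in>?I. \<lambda>j\<in>?I. \<zero>) k j) = (\<Oplus>k\<in>?I. A i k \<otimes> \<zero>)"
        using e ij by (intro sum_cong) auto
      also have "\<dots> = \<zero>"
        using e ij by (intro zl) auto
      finally show "(A \<otimes>\<^bsub>mat_semiring S n\<^esub> \<zero>\<^bsub>mat_semiring S n\<^esub>) i j = \<zero>\<^bsub>mat_semiring S n\<^esub> i j"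
        using ij by (simp add: mat_semiring_def)
    qed (use A in \<open>auto simp only: mat_semiring_def ring.simps monoid.simps partial_object.simps intro!: mem\<close>)
  next
    show "\<zero>\<^bsub>mat_semiring S n\<^esub> \<in> ?I \<rightarrow>\<^sub>E (?I \<rightarrow>\<^sub>E carrier S)"
      using zero_mem by (simp add: mat_semiring_def)
    show "\<one>\<^bsub>mat_semiring S n\<^esub> \<in> ?I \<rightarrow>\<^sub>E (?I \<rightarrow>\<^sub>E carrier S)"
      using one_mem by (simp add: mat_semiring_def)
  qed
qed


subsection \<open>Independence of projectivity from the choice of types\<close>

definition free_semimodule :: "('a, 'r) ring_scheme \<Rightarrow> 'b set \<Rightarrow> ('a, 'b \<Rightarrow> 'a) module"
  where "free_semimodule S X =
    \<lparr>carrier = {\<phi>. (\<forall>x. \<phi> x \<in> carrier S) \<and> finite {x. \<phi> x \<noteq> \<zero>\<^bsub>S\<^esub>} \<and> {x. \<phi> x \<noteq> \<zero>\<^bsub>S\<^esub>} \<subseteq> X},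
     mult = undefined,
     one = undefined,
     zero = (\<lambda>x. \<zero>\<^bsub>S\<^esub>),
     add = (\<lambda>\<phi> \<psi> x. \<phi> x \<oplus>\<^bsub>S\<^esub> \<psi> x),
     smult = (\<lambda>a \<phi> x. a \<otimes>\<^bsub>S\<^esub> \<phi> x)\<rparr>"

definition free_ext ::
  "('a, 'r) ring_scheme \<Rightarrow> ('a, 'c, 'k) module_scheme \<Rightarrow> ('b \<Rightarrow> 'c) \<Rightarrow> ('b \<Rightarrow> 'a) \<Rightarrow> 'c"
  where "free_ext S N t \<phi> = (\<Oplus>\<^bsub>N\<^esub>x\<in>{x. \<phi> x \<noteq> \<zero>\<^bsub>S\<^esub>}. \<phi> x \<odot>\<^bsub>N\<^esub> t x)"

lemma semimodule_free_semimodule: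
  fixes S (structure)
  assumes "semiring S"
  shows "semimodule S (free_semimodule S X)"
proof -
  interpret semiring S by fact
  have supp_add: "finite {x. \<phi> x \<oplus> \<psi> x \<noteq> \<zero>}"
    if "finite {x. \<phi> x \<noteq> \<zero>}" "finite {x. \<psi> x \<noteq> \<zero>}" for \<phi> \<psi> :: "_ \<Rightarrow> 'a"
    by (rule finite_subset[of _ "{x. \<phi> x \<noteq> \<zero>} \<union> {x. \<psi> x \<noteq> \<zero>}"]) (use that in auto)
  have supp_smult: "finite {x. a \<otimes> \<phi> x \<noteq> \<zero>}"
    if "finite {x. \<phi> x \<noteq> \<zero>}" "a \<in> carrier S" for \<phi> :: "_ \<Rightarrow> 'a" and a
    by (rule finite_subset[of _ "{x. \<phi> x \<noteq> \<zero>}"]) (use that in auto)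
  have ne: "\<phi> x \<noteq> \<zero> \<or> \<psi> x \<noteq> \<zero>" if "\<phi> x \<oplus> \<psi> x \<noteq> \<zero>" for \<phi> \<psi> :: "'b \<Rightarrow> 'a" and x
    using that by auto
  show ?thesis
  proof (intro semimodule.intro semimodule_axioms.intro)
    show "semiring S" by fact
    show "abelian_monoid (free_semimodule S X)"
      by (rule abelian_monoidI)
         (auto simp: free_semimodule_def a_ac supp_add dest!: ne)
  next
    fix a \<phi> assume "a \<in> carrier S" "\<phi> \<in> carrier (free_semimodule S X)"
    then show "a \<odot>\<^bsub>free_semimodule S X\<^esub> \<phi> \<in> carrier (free_semimodule S X)"
      by (auto simp: free_semimodule_def supp_smult)
  qed (auto simp: free_semimodule_def m_assoc l_distr r_distr)
qed

lemma free_ext_superset: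
  assumes "semimodule S N" "t \<in> X \<rightarrow> carrier N" "\<phi> \<in> carrier (free_semimodule S X)"
    and "finite A" "{x. \<phi> x \<noteq> \<zero>\<^bsub>S\<^esub>} \<subseteq> A" "A \<subseteq> X"
  shows "free_ext S N t \<phi> = (\<Oplus>\<^bsub>N\<^esub>x\<in>A. \<phi> x \<odot>\<^bsub>N\<^esub> t x)"
proof -
  interpret N: semimodule S N by fact
  have t: "t x \<in> carrier N" if "x \<in> A" for x
    using assms(2,6) that by auto
  show ?thesis
    unfolding free_ext_def using assms(3-5) t
    by (intro N.M.add.finprod_mono_neutral_cong_left)
       (auto simp: free_semimodule_def)
qed

lemma free_ext_hom:
  assumes "semimodule S N" "t \<in> X \<rightarrow> carrier N"
  shows "free_ext S N t \<in> semimodule_hom S (free_semimodule S X) N"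
proof -
  interpret N: semimodule S N by fact
  interpret F: semimodule S "free_semimodule S X"
    by (rule semimodule_free_semimodule) (rule N.S.semiring_axioms)
  note ext = free_ext_superset[OF assms]
  have t: "t x \<in> carrier N" if "x \<in> X" for x
    using assms(2) that by auto
  show ?thesis
  proof (rule semimodule_homI)
    fix \<phi> assume "\<phi> \<in> carrier (free_semimodule S X)"
    then show "free_ext S N t \<phi> \<in> carrier N"
      using t unfolding free_ext_def free_semimodule_def by (intro N.M.finsum_closed) auto
  next
    fix \<phi> \<psi> assume \<phi>: "\<phi> \<in> carrier (free_semimodule S X)" and \<psi>: "\<psi> \<in> carrier (free_semimodule S X)"
    let ?A = "{x. \<phi> x \<noteq> \<zero>\<^bsub>S\<^esub>} \<union> {x. \<psi> x \<noteq> \<zero>\<^bsub>S\<^esub>}"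
    have A: "finite ?A" "?A \<subseteq> X" and c: "\<And>x. \<phi> x \<in> carrier S" "\<And>x. \<psi> x \<in> carrier S"
      using \<phi> \<psi> by (auto simp: free_semimodule_def)
    have "free_ext S N t (\<phi> \<oplus>\<^bsub>free_semimodule S X\<^esub> \<psi>)
        = (\<Oplus>\<^bsub>N\<^esub>x\<in>?A. (\<phi> \<oplus>\<^bsub>free_semimodule S X\<^esub> \<psi>) x \<odot>\<^bsub>N\<^esub> t x)"
      using \<phi> \<psi> A c by (intro ext F.M.a_closed) (auto simp: free_semimodule_def)
    also have "\<dots> = (\<Oplus>\<^bsub>N\<^esub>x\<in>?A. \<phi> x \<odot>\<^bsub>N\<^esub> t x \<oplus>\<^bsub>N\<^esub> \<psi> x \<odot>\<^bsub>N\<^esub> t x)"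
      using A c t by (intro N.M.finsum_cong') (auto simp: free_semimodule_def N.smult_l_distr)
    also have "\<dots> = (\<Oplus>\<^bsub>N\<^esub>x\<in>?A. \<phi> x \<odot>\<^bsub>N\<^esub> t x) \<oplus>\<^bsub>N\<^esub> (\<Oplus>\<^bsub>N\<^esub>x\<in>?A. \<psi> x \<odot>\<^bsub>N\<^esub> t x)"
      using A c t by (intro N.M.finsum_addf) auto
    also have "\<dots> = free_ext S N t \<phi> \<oplus>\<^bsub>N\<^esub> free_ext S N t \<psi>"
      using ext[OF \<phi> A(1) _ A(2)] ext[OF \<psi> A(1) _ A(2)] by simp
    finally show "free_ext S N t (\<phi> \<oplus>\<^bsub>free_semimodule S X\<^esub> \<psi>)
        = free_ext S N t \<phi> \<oplus>\<^bsub>N\<^esub> free_ext S N t \<psi>" .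
  next
    fix a \<phi> assume a: "a \<in> carrier S" and \<phi>: "\<phi> \<in> carrier (free_semimodule S X)"
    let ?A = "{x. \<phi> x \<noteq> \<zero>\<^bsub>S\<^esub>}"
    have A: "finite ?A" "?A \<subseteq> X" and c: "\<And>x. \<phi> x \<in> carrier S"
      using \<phi> by (auto simp: free_semimodule_def)
    have "free_ext S N t (a \<odot>\<^bsub>free_semimodule S X\<^esub> \<phi>)
        = (\<Oplus>\<^bsub>N\<^esub>x\<in>?A. (a \<odot>\<^bsub>free_semimodule S X\<^esub> \<phi>) x \<odot>\<^bsub>N\<^esub> t x)"
      using a \<phi> A c by (intro ext F.smult_closed) (auto simp: free_semimodule_def)
    also have "\<dots> = (\<Oplus>\<^bsub>N\<^esub>x\<in>?A. a \<odot>\<^bsub>N\<^esub> (\<phi> x \<odot>\<^bsub>N\<^esub> t x))"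
      using A a c t by (intro N.M.finsum_cong') (auto simp: free_semimodule_def N.smult_assoc)
    also have "\<dots> = a \<odot>\<^bsub>N\<^esub> free_ext S N t \<phi>"
      unfolding free_ext_def using A a c t by (intro N.finsum_smult_distr[symmetric]) auto
    finally show "free_ext S N t (a \<odot>\<^bsub>free_semimodule S X\<^esub> \<phi>) = a \<odot>\<^bsub>N\<^esub> free_ext S N t \<phi>" .
  qed
qed

lemma projective_lifts:
  fixes P :: "('a, 'b, 'm) module_scheme"
    and M' :: "('a, 'c, 'k) module_scheme" and N' :: "('a, 'd, 'l) module_scheme"
  assumes "semimodule S P" "projective S P" "semimodule S M'" "semimodule S N'"
  shows "lifts_along S P M' N'"
  unfolding lifts_along_def
proof (intro ballI impI)
  fix g f
  assume g: "g \<in> semimodule_hom S M' N'" and f: "f \<in> semimodule_hom S P N'"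
    and surj: "g ` carrier M' = carrier N'"
  interpret P: semimodule S P by fact
  interpret M: semimodule S M' by fact
  interpret N: semimodule S N' by fact
  define Q where "Q = module.truncate P"
  let ?F = "free_semimodule S (carrier P)"
  have Qs: "carrier Q = carrier P" "add Q = add P" "zero Q = zero P" "smult Q = smult P"
    by (simp_all add: Q_def module.truncate_def)
  have F: "semimodule S ?F"
    by (rule semimodule_free_semimodule) (rule P.S.semiring_axioms)
  have Q: "semimodule S Q"
  proof (intro semimodule.intro semimodule_axioms.intro)
    show "semiring S" by (rule P.S.semiring_axioms)
    show "abelian_monoid Q"
      by (rule abelian_monoidI) (auto simp: Qs P.M.a_ac)
  qed (auto simp: Qs P.smult_assoc P.smult_l_distr P.smult_r_distr)
  let ?e = "free_ext S Q (\<lambda>x. x)"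
  have e: "?e \<in> semimodule_hom S ?F Q"
    by (rule free_ext_hom[OF Q]) (auto simp: Qs)
  have e_surj: "?e ` carrier ?F = carrier Q"
  proof
    show "?e ` carrier ?F \<subseteq> carrier Q"
      using semimodule_homD(1)[OF e] by auto
    show "carrier Q \<subseteq> ?e ` carrier ?F"
    proof
      interpret Q: semimodule S Q by fact
      fix x assume x: "x \<in> carrier Q"
      let ?\<delta> = "\<lambda>y. if y = x then \<one>\<^bsub>S\<^esub> else \<zero>\<^bsub>S\<^esub>"
      have \<delta>: "?\<delta> \<in> carrier ?F"
        using x by (auto simp: free_semimodule_def Qs intro: finite_subset[of _ "{x}"])
      have "?e ?\<delta> = (\<Oplus>\<^bsub>Q\<^esub>y\<in>{x}. ?\<delta> y \<odot>\<^bsub>Q\<^esub> y)"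
        by (rule free_ext_superset[OF Q _ \<delta>]) (use x in \<open>auto simp: Qs\<close>)
      also have "\<dots> = x"
        using x by simp
      finally show "x \<in> ?e ` carrier ?F"
        using \<delta> by (metis imageI)
    qed
  qed
  have id: "(\<lambda>x. x) \<in> semimodule_hom S P Q"
    by (rule semimodule_homI) (simp_all add: Qs)
  have "lifts_along S P ?F Q"
    using assms(2) F Q by (simp add: projective_def)
  note this[unfolded lifts_along_def, rule_format, OF e id e_surj]
  then obtain s where s: "s \<in> semimodule_hom S P ?F" "\<And>x. x \<in> carrier P \<Longrightarrow> ?e (s x) = x"
    by (elim bexE) simp
  have "\<forall>y\<in>carrier P. \<exists>m\<in>carrier M'. g m = f y"
    using surj semimodule_homD(1)[OF f] by (metis imageE)
  then obtain t where t: "\<And>y. y \<in> carrier P \<Longrightarrow> t y \<in> carrier M'"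
      "\<And>y. y \<in> carrier P \<Longrightarrow> g (t y) = f y"
    by metis
  let ?h = "free_ext S M' t"
  have h: "?h \<in> semimodule_hom S ?F M'"
    by (rule free_ext_hom[OF assms(3)]) (use t in auto)
  have f': "f \<in> semimodule_hom S Q N'"
    using f by (simp add: semimodule_hom_def Qs)
  have gh: "g (?h \<phi>) = f (?e \<phi>)" if "\<phi> \<in> carrier ?F" for \<phi>
  proof -
    let ?A = "{x. \<phi> x \<noteq> \<zero>\<^bsub>S\<^esub>}"
    have A: "finite ?A" "?A \<subseteq> carrier P" "\<And>x. \<phi> x \<in> carrier S"
      using that by (auto simp: free_semimodule_def)
    have "g (?h \<phi>) = (\<Oplus>\<^bsub>N'\<^esub>x\<in>?A. g (\<phi> x \<odot>\<^bsub>M'\<^esub> t x))"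
      unfolding free_ext_def using A t
      by (intro semimodule_hom_finsum[OF assms(3,4) g]) auto
    also have "\<dots> = (\<Oplus>\<^bsub>N'\<^esub>x\<in>?A. f (\<phi> x \<odot>\<^bsub>Q\<^esub> x))"
    proof (rule N.M.finsum_cong')
      show "(\<lambda>x. f (\<phi> x \<odot>\<^bsub>Q\<^esub> x)) \<in> ?A \<rightarrow> carrier N'"
        using A semimodule_homD(1)[OF f] by (auto simp: Qs)
      fix x assume "x \<in> ?A"
      then have "x \<in> carrier P" using A by auto
      then show "g (\<phi> x \<odot>\<^bsub>M'\<^esub> t x) = f (\<phi> x \<odot>\<^bsub>Q\<^esub> x)"
        using A t by (simp add: Qs semimodule_homD(3)[OF g] semimodule_homD(3)[OF f])
    qed simp
    also have "\<dots> = f (?e \<phi>)"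
      unfolding free_ext_def using A
      by (intro semimodule_hom_finsum[OF Q assms(4) f', symmetric]) (auto simp: Qs)
    finally show ?thesis .
  qed
  show "\<exists>f' \<in> semimodule_hom S P M'. \<forall>x\<in>carrier P. g (f' x) = f x"
  proof (rule bexI[of _ "\<lambda>x. ?h (s x)"])
    show "(\<lambda>x. ?h (s x)) \<in> semimodule_hom S P M'"
      using s(1) h by (auto simp: semimodule_hom_def Pi_iff)
    show "\<forall>x\<in>carrier P. g (?h (s x)) = f x"
      using gh s semimodule_homD(1)[OF s(1)] by simp
  qed
qed

end

theory Submission
  imports Defs
begin

text \<open>
  A choice of \<open>n\<close> elements \<open>x\<^sub>1, \<dots>, x\<^sub>n\<close> of a semimodule \<open>N\<close> is the same as a homomorphism
  \<open>S\<^sup>n \<rightarrow> N\<close>, \<open>a \<mapsto> \<Sum> a\<^sub>i x\<^sub>i\<close>, with the span of the \<open>x\<^sub>i\<close> as its image. For \<open>N = S\<^sup>n\<close> and the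
  rows \<open>u\<^sub>i\<close> of a matrix \<open>U\<close> this homomorphism is \<open>a \<mapsto> aU\<close>, and \<open>U\<close> is idempotent if and only
  if the homomorphism fixes every \<open>u\<^sub>i\<close> (\<open>idempotent_iff_rows_fixed\<close>). Both directions of the
  theorem are then the familiar fact that the projective semimodules are the retracts of free
  ones.

  If \<open>M\<close> is projective and generated by the \<open>x\<^sub>i\<close>, then the surjection \<open>g : S\<^sup>n \<rightarrow> M\<close> has a
  section \<open>s\<close>. Put \<open>u\<^sub>i = s x\<^sub>i\<close>. The section is injective with image the span of the \<open>u\<^sub>i\<close>, and
  \<open>a \<mapsto> aU\<close> is \<open>s \<circ> g\<close>, which fixes everything in the image of \<open>s\<close>
  (\<open>projective_imp_idempotent\<close>).

  Conversely, if \<open>U\<close> is idempotent then \<open>p = \<Sum> p\<^sub>j u\<^sub>j\<close> for every \<open>p\<close> in the span \<open>P\<close> of its rows.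
  The coordinates of \<open>p\<close> are thus coefficients expressing it by the generators \<open>u\<^sub>j\<close>, and they
  depend on \<open>p\<close> linearly. A homomorphism out of \<open>P\<close> is therefore lifted by lifting its
  values at the \<open>u\<^sub>j\<close> arbitrarily to \<open>t\<^sub>j\<close> and sending \<open>p\<close> to \<open>\<Sum> p\<^sub>j t\<^sub>j\<close>
  (\<open>idempotent_imp_projective\<close>).
\<close>


section \<open>Linear combinations as homomorphisms from the free semimodule\<close>

definition lin_comb ::
  "('a, 'r) ring_scheme \<Rightarrow> ('a, 'b, 'm) module_scheme \<Rightarrow> nat \<Rightarrow> (nat \<Rightarrow> 'b) \<Rightarrow> (nat \<Rightarrow> 'a) \<Rightarrow> 'b"
  where "lin_comb S N n x a = (\<Oplus>\<^bsub>N\<^esub>i\<in>{1..n}. a i \<odot>\<^bsub>N\<^esub> x i)"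

lemma vec_carrierD:
  "\<lbrakk>a \<in> carrier (vec_semimodule S n); i \<in> {1..n}\<rbrakk> \<Longrightarrow> a i \<in> carrier S"
  by (auto simp: vec_semimodule_def PiE_iff)

lemma span_family_eq_lin_comb:
  "span_family S N n x = lin_comb S N n x ` ({1..n} \<rightarrow> carrier S)"
  unfolding span_family_def lin_comb_def by (rule Setcompr_eq_image)

lemma lin_comb_cong:
  assumes "semimodule S N" "y \<in> {1..n} \<rightarrow> carrier N" "b \<in> {1..n} \<rightarrow> carrier S"
    and "\<And>i. i \<in> {1..n} \<Longrightarrow> x i = y i" "\<And>i. i \<in> {1..n} \<Longrightarrow> a i = b i"
  shows "lin_comb S N n x a = lin_comb S N n y b"
proof -
  interpret semimodule S N by fact
  show ?thesis
    unfolding lin_comb_def using assms(2-) by (intro M.finsum_cong') (auto simp: Pi_iff)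
qed

lemma lin_comb_hom:
  assumes "semimodule S N" "x \<in> {1..n} \<rightarrow> carrier N"
  shows "lin_comb S N n x \<in> semimodule_hom S (vec_semimodule S n) N"
proof -
  interpret semimodule S N by fact
  have x: "x i \<in> carrier N" if "i \<in> {1..n}" for i
    using assms(2) that by auto
  note c = vec_carrierD[of _ S n]
  show ?thesis
  proof (rule semimodule_homI)
    fix a assume a: "a \<in> carrier (vec_semimodule S n)"
    show "lin_comb S N n x a \<in> carrier N"
      unfolding lin_comb_def using c[OF a] x by (intro M.finsum_closed) auto
  next
    fix a b
    assume a: "a \<in> carrier (vec_semimodule S n)" and b: "b \<in> carrier (vec_semimodule S n)"
    have "lin_comb S N n x (a \<oplus>\<^bsub>vec_semimodule S n\<^esub> b)
        = (\<Oplus>\<^bsub>N\<^esub>i\<in>{1..n}. a i \<odot>\<^bsub>N\<^esub> x i \<oplus>\<^bsub>N\<^esub> b i \<odot>\<^bsub>N\<^esub> x i)"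
      unfolding lin_comb_def using c[OF a] c[OF b] x
      by (intro M.finsum_cong') (auto simp: vec_semimodule_def smult_l_distr)
    also have "\<dots> = lin_comb S N n x a \<oplus>\<^bsub>N\<^esub> lin_comb S N n x b"
      unfolding lin_comb_def using c[OF a] c[OF b] x by (intro M.finsum_addf) auto
    finally show "lin_comb S N n x (a \<oplus>\<^bsub>vec_semimodule S n\<^esub> b)
        = lin_comb S N n x a \<oplus>\<^bsub>N\<^esub> lin_comb S N n x b" .
  next
    fix r a assume r: "r \<in> carrier S" and a: "a \<in> carrier (vec_semimodule S n)"
    have "lin_comb S N n x (r \<odot>\<^bsub>vec_semimodule S n\<^esub> a)
        = (\<Oplus>\<^bsub>N\<^esub>i\<in>{1..n}. r \<odot>\<^bsub>N\<^esub> (a i \<odot>\<^bsub>N\<^esub> x i))"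
      unfolding lin_comb_def using r c[OF a] x
      by (intro M.finsum_cong') (auto simp: vec_semimodule_def smult_assoc)
    also have "\<dots> = r \<odot>\<^bsub>N\<^esub> lin_comb S N n x a"
      unfolding lin_comb_def using r c[OF a] x
      by (intro finsum_smult_distr[symmetric]) auto
    finally show "lin_comb S N n x (r \<odot>\<^bsub>vec_semimodule S n\<^esub> a) = r \<odot>\<^bsub>N\<^esub> lin_comb S N n x a" .
  qed
qed

lemma lin_comb_image:
  assumes "semimodule S N" "x \<in> {1..n} \<rightarrow> carrier N"
  shows "lin_comb S N n x ` carrier (vec_semimodule S n) = span_family S N n x"
proof
  show "lin_comb S N n x ` carrier (vec_semimodule S n) \<subseteq> span_family S N n x"
    unfolding span_family_eq_lin_comb
    by (rule image_mono) (auto simp: vec_semimodule_def)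
next
  show "span_family S N n x \<subseteq> lin_comb S N n x ` carrier (vec_semimodule S n)"
  proof
    fix y assume "y \<in> span_family S N n x"
    then obtain a where a: "a \<in> {1..n} \<rightarrow> carrier S" "y = lin_comb S N n x a"
      unfolding span_family_eq_lin_comb by blast
    have "y = lin_comb S N n x (restrict a {1..n})"
      unfolding a(2) using assms a(1) by (intro lin_comb_cong) auto
    moreover have "restrict a {1..n} \<in> carrier (vec_semimodule S n)"
      using a(1) by (auto simp: vec_semimodule_def)
    ultimately show "y \<in> lin_comb S N n x ` carrier (vec_semimodule S n)"
      by blast
  qed
qed

lemma hom_lin_comb:
  assumes "semimodule S N" "semimodule S N'" "h \<in> semimodule_hom S N N'"
    and "x \<in> {1..n} \<rightarrow> carrier N" "a \<in> {1..n} \<rightarrow> carrier S"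
  shows "h (lin_comb S N n x a) = lin_comb S N' n (\<lambda>i. h (x i)) a"
proof -
  interpret N: semimodule S N by fact
  interpret N': semimodule S N' by fact
  have "h (lin_comb S N n x a) = (\<Oplus>\<^bsub>N'\<^esub>i\<in>{1..n}. h (a i \<odot>\<^bsub>N\<^esub> x i))"
    unfolding lin_comb_def using assms(4,5)
    by (intro semimodule_hom_finsum[OF assms(1-3)]) (auto simp: Pi_iff)
  also have "\<dots> = lin_comb S N' n (\<lambda>i. h (x i)) a"
    unfolding lin_comb_def using assms(4,5) semimodule_homD(1,3)[OF assms(3)]
    by (intro N'.M.finsum_cong') (auto simp: Pi_iff)
  finally show ?thesis .
qed

lemma hom_image_span:
  assumes "semimodule S N" "semimodule S N'" "h \<in> semimodule_hom S N N'"
    and "x \<in> {1..n} \<rightarrow> carrier N"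
  shows "h ` span_family S N n x = span_family S N' n (\<lambda>i. h (x i))"
proof -
  have hx: "(\<lambda>i. h (x i)) \<in> {1..n} \<rightarrow> carrier N'"
    using assms(4) semimodule_homD(1)[OF assms(3)] by auto
  have "h (lin_comb S N n x a) = lin_comb S N' n (\<lambda>i. h (x i)) a"
    if "a \<in> carrier (vec_semimodule S n)" for a
    using vec_carrierD[OF that] by (intro hom_lin_comb[OF assms]) auto
  then show ?thesis
    by (simp add: lin_comb_image[OF assms(1,4), symmetric]
        lin_comb_image[OF assms(2) hx, symmetric] image_image)
qed

lemma span_family_generator:
  assumes "semimodule S N" "x \<in> {1..n} \<rightarrow> carrier N" "i \<in> {1..n}"
  shows "x i \<in> span_family S N n x"
proof -
  interpret semimodule S N by fact
  let ?d = "\<lambda>j. if i = j then \<one>\<^bsub>S\<^esub> else \<zero>\<^bsub>S\<^esub>"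
  have "(\<Oplus>\<^bsub>N\<^esub>j\<in>{1..n}. ?d j \<odot>\<^bsub>N\<^esub> x j) = (\<Oplus>\<^bsub>N\<^esub>j\<in>{1..n}. if i = j then x j else \<zero>\<^bsub>N\<^esub>)"
    using assms(2) by (intro M.finsum_cong') (auto simp: Pi_iff)
  also have "\<dots> = x i"
    using assms(2,3) by (intro M.finsum_singleton) auto
  finally have "x i = lin_comb S N n x ?d"
    by (simp add: lin_comb_def)
  moreover have "?d \<in> {1..n} \<rightarrow> carrier S"
    by auto
  ultimately show ?thesis
    unfolding span_family_eq_lin_comb by blast
qed


section \<open>Idempotent matrices\<close>

lemma finsum_vec:
  assumes "semiring S" "finite A" "f \<in> A \<rightarrow> carrier (vec_semimodule S n)" "j \<in> {1..n}"
  shows "(\<Oplus>\<^bsub>vec_semimodule S n\<^esub>k\<in>A. f k) j = (\<Oplus>\<^bsub>S\<^esub>k\<in>A. f k j)"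
  using assms(2,3)
proof (induction A rule: finite_induct)
  interpret S: semiring S by fact
  interpret V: semimodule S "vec_semimodule S n"
    by (rule semimodule_vec_semimodule) fact
  case empty
  have "\<zero>\<^bsub>vec_semimodule S n\<^esub> j = \<zero>\<^bsub>S\<^esub>"
    using assms(4) by (simp add: vec_semimodule_def)
  then show ?case by simp
next
  interpret S: semiring S by fact
  interpret V: semimodule S "vec_semimodule S n"
    by (rule semimodule_vec_semimodule) fact
  case (insert k A)
  have f: "f k \<in> carrier (vec_semimodule S n)" "f \<in> A \<rightarrow> carrier (vec_semimodule S n)"
    using insert.prems by auto
  have fj: "f k j \<in> carrier S" "(\<lambda>k. f k j) \<in> A \<rightarrow> carrier S"
    using f assms(4) by (auto intro: vec_carrierD)
  have "(f k \<oplus>\<^bsub>vec_semimodule S n\<^esub> v) j = f k j \<oplus>\<^bsub>S\<^esub> v j" for v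
    using assms(4) by (simp add: vec_semimodule_def)
  then show ?case
    using insert.hyps insert.IH[OF f(2)] f fj by simp
qed

text \<open>
  Row \<open>i\<close> of \<open>U \<star> U\<close> is the row vector \<open>u\<^sub>i\<close> times \<open>U\<close>, that is, the combination of the rows
  of \<open>U\<close> with coefficients \<open>u\<^sub>i\<close>. This turns idempotence into a statement about a
  homomorphism.
\<close>

lemma idempotent_iff_rows_fixed:
  fixes S :: "('a, 'r) ring_scheme"
  assumes "semiring S" and u: "u \<in> {1..n} \<rightarrow> carrier (vec_semimodule S n)"
  defines "U \<equiv> \<lambda>i\<in>{1..n}. \<lambda>j\<in>{1..n}. u i j"
  shows "U \<in> carrier (mat_semiring S n)"
    and "U \<otimes>\<^bsub>mat_semiring S n\<^esub> U = U \<longleftrightarrow>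
      (\<forall>i\<in>{1..n}. lin_comb S (vec_semimodule S n) n u (u i) = u i)"
proof -
  interpret S: semiring S by fact
  let ?V = "vec_semimodule S n"
  interpret V: semimodule S ?V
    by (rule semimodule_vec_semimodule) fact
  have c: "u i j \<in> carrier S" if "i \<in> {1..n}" "j \<in> {1..n}" for i j
    using vec_carrierD[OF Pi_mem[OF u that(1)] that(2)] .
  show U: "U \<in> carrier (mat_semiring S n)"
    using c by (auto simp: U_def mat_semiring_def)
  have prod: "(U \<otimes>\<^bsub>mat_semiring S n\<^esub> U) i j = lin_comb S ?V n u (u i) j"
    if "i \<in> {1..n}" "j \<in> {1..n}" for i j
  proof -
    have "lin_comb S ?V n u (u i) j = (\<Oplus>\<^bsub>S\<^esub>k\<in>{1..n}. (u i k \<odot>\<^bsub>?V\<^esub> u k) j)"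
      unfolding lin_comb_def using u c that
      by (intro finsum_vec assms(1)) auto
    also have "\<dots> = (\<Oplus>\<^bsub>S\<^esub>k\<in>{1..n}. u i k \<otimes>\<^bsub>S\<^esub> u k j)"
      using that c by (intro S.finsum_cong') (auto simp: vec_semimodule_def)
    also have "\<dots> = (\<Oplus>\<^bsub>S\<^esub>k\<in>{1..n}. U i k \<otimes>\<^bsub>S\<^esub> U k j)"
      using that c by (intro S.finsum_cong') (auto simp: U_def)
    finally show ?thesis
      using that by (simp add: mat_semiring_def)
  qed
  have row: "(U \<otimes>\<^bsub>mat_semiring S n\<^esub> U) i = lin_comb S ?V n u (u i)" and Ui: "U i = u i"
    if i: "i \<in> {1..n}" for i
  proof -
    have ui: "u i \<in> carrier ?V"
      using u i by auto
    have "lin_comb S ?V n u (u i) \<in> carrier ?V"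
      by (rule semimodule_homD(1)[OF lin_comb_hom[OF V.semimodule_axioms u] ui])
    then have "lin_comb S ?V n u (u i) \<in> extensional {1..n}"
      by (simp add: vec_semimodule_def PiE_iff)
    moreover have "(U \<otimes>\<^bsub>mat_semiring S n\<^esub> U) i \<in> extensional {1..n}"
      using i by (simp add: mat_semiring_def)
    ultimately show "(U \<otimes>\<^bsub>mat_semiring S n\<^esub> U) i = lin_comb S ?V n u (u i)"
      using prod[OF i] by (intro extensionalityI[of _ "{1..n}"])
    show "U i = u i"
      using i ui by (simp add: U_def vec_semimodule_def PiE_iff extensional_restrict)
  qed
  have ext: "U \<otimes>\<^bsub>mat_semiring S n\<^esub> U \<in> extensional {1..n}" "U \<in> extensional {1..n}"
    by (simp_all add: U_def mat_semiring_def)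
  show "U \<otimes>\<^bsub>mat_semiring S n\<^esub> U = U \<longleftrightarrow> (\<forall>i\<in>{1..n}. lin_comb S ?V n u (u i) = u i)"
  proof
    assume "U \<otimes>\<^bsub>mat_semiring S n\<^esub> U = U"
    then show "\<forall>i\<in>{1..n}. lin_comb S ?V n u (u i) = u i"
      using row Ui by metis
  next
    assume "\<forall>i\<in>{1..n}. lin_comb S ?V n u (u i) = u i"
    then show "U \<otimes>\<^bsub>mat_semiring S n\<^esub> U = U"
      using row Ui by (intro extensionalityI[OF ext]) auto
  qed
qed

text \<open>
  An element of the span is \<open>aU\<close> for some \<open>a\<close>, so \<open>U\<close> being idempotent makes
  \<open>p \<mapsto> pU\<close> the identity on the span.
\<close>

lemma rows_fixed_imp_span_fixed:
  assumes "semiring S" and u: "u \<in> {1..n} \<rightarrow> carrier (vec_semimodule S n)"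
    and fixed: "\<And>i. i \<in> {1..n} \<Longrightarrow> lin_comb S (vec_semimodule S n) n u (u i) = u i"
    and p: "p \<in> span_family S (vec_semimodule S n) n u"
  shows "lin_comb S (vec_semimodule S n) n u p = p"
proof -
  let ?V = "vec_semimodule S n"
  note V = semimodule_vec_semimodule[OF assms(1), of n]
  obtain a where a: "a \<in> {1..n} \<rightarrow> carrier S" "p = lin_comb S ?V n u a"
    using p unfolding span_family_eq_lin_comb by blast
  have "lin_comb S ?V n u p = lin_comb S ?V n (\<lambda>i. lin_comb S ?V n u (u i)) a"
    unfolding a(2) by (rule hom_lin_comb[OF V V lin_comb_hom[OF V u] u a(1)])
  also have "\<dots> = p"
    unfolding a(2) using V u a(1) fixed by (intro lin_comb_cong) auto
  finally show ?thesis .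
qed


section \<open>Projectivity\<close>

text \<open>
  A section \<open>s\<close> of the surjection \<open>g : S\<^sup>n \<rightarrow> M\<close> makes \<open>s \<circ> g\<close> an idempotent endomorphism of
  \<open>S\<^sup>n\<close> with image isomorphic to \<open>M\<close>. Its matrix has the rows \<open>s (g e\<^sub>i) = s x\<^sub>i\<close>, for the
  standard basis vectors \<open>e\<^sub>i\<close>.
\<close>

lemma projective_imp_idempotent:
  fixes S :: "('a, 'r) ring_scheme" and M :: "('a, 'b, 'm) module_scheme"
  assumes "semimodule S M" "n_generated S n M" "projective S M"
  obtains u where "u \<in> {1..n} \<rightarrow> carrier (vec_semimodule S n)"
    and "semimodule_isomorphic S M (generated_subsemimodule S (vec_semimodule S n) n u)"
    and "\<And>i. i \<in> {1..n} \<Longrightarrow> lin_comb S (vec_semimodule S n) n u (u i) = u i"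
proof -
  interpret M: semimodule S M by fact
  let ?V = "vec_semimodule S n"
  have V: "semimodule S ?V"
    by (rule semimodule_vec_semimodule) (rule M.S.semiring_axioms)
  obtain x where x: "x \<in> {1..n} \<rightarrow> carrier M" "carrier M = span_family S M n x"
    using assms(2) by (auto simp: n_generated_def)
  let ?g = "lin_comb S M n x"
  have g: "?g \<in> semimodule_hom S ?V M" "?g ` carrier ?V = carrier M"
    using lin_comb_hom[OF assms(1) x(1)] lin_comb_image[OF assms(1) x(1)] x(2) by auto
  have id: "(\<lambda>y. y) \<in> semimodule_hom S M M"
    by (rule semimodule_homI) simp_all
  obtain s where s: "s \<in> semimodule_hom S M ?V" "\<And>y. y \<in> carrier M \<Longrightarrow> ?g (s y) = y"
    using projective_lifts[OF assms(1,3) V assms(1), unfolded lifts_along_def,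
        rule_format, OF g(1) id g(2)] by blast
  let ?u = "\<lambda>i. s (x i)"
  have u: "?u \<in> {1..n} \<rightarrow> carrier ?V"
    using x(1) semimodule_homD(1)[OF s(1)] by auto
  have img: "s ` carrier M = span_family S ?V n ?u"
    using hom_image_span[OF assms(1) V s(1) x(1)] x(2) by simp
  have "inj_on s (carrier M)"
    by (rule inj_on_inverseI[of _ ?g]) (rule s(2))
  then have "bij_betw s (carrier M) (carrier (generated_subsemimodule S ?V n ?u))"
    using img by (simp add: bij_betw_def generated_subsemimodule_def)
  moreover have "s \<in> semimodule_hom S M (generated_subsemimodule S ?V n ?u)"
    using s(1) img by (auto simp: semimodule_hom_def generated_subsemimodule_def)
  ultimately have iso: "semimodule_isomorphic S M (generated_subsemimodule S ?V n ?u)"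
    by (auto simp: semimodule_isomorphic_def)
  have "lin_comb S ?V n ?u (?u i) = ?u i" if i: "i \<in> {1..n}" for i
  proof -
    have xi: "x i \<in> carrier M"
      using x(1) i by auto
    have "?u i \<in> {1..n} \<rightarrow> carrier S"
      using vec_carrierD[OF semimodule_homD(1)[OF s(1) xi]] by auto
    then have "lin_comb S ?V n ?u (?u i) = s (?g (?u i))"
      by (rule hom_lin_comb[OF assms(1) V s(1) x(1), symmetric])
    then show ?thesis
      by (simp add: s(2)[OF xi])
  qed
  with u iso show thesis
    by (rule that)
qed

text \<open>
  The isomorphism \<open>\<phi>\<close> onto the span turns the coordinates of \<open>\<phi> y\<close> into coefficients that
  write \<open>y\<close> in terms of the elements \<open>w\<^sub>i\<close> with \<open>\<phi> w\<^sub>i = u\<^sub>i\<close>. Coefficients that depend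
  linearly on \<open>y\<close> in this way (a finite dual basis) let one lift a homomorphism by choosing
  lifts \<open>t\<^sub>i\<close> of its values at the \<open>w\<^sub>i\<close> alone; no compatibility between the choices arises.
\<close>

lemma idempotent_imp_projective:
  fixes S :: "('a, 'r) ring_scheme" and M :: "('a, 'b, 'm) module_scheme"
  assumes "semimodule S M" and u: "u \<in> {1..n} \<rightarrow> carrier (vec_semimodule S n)"
    and iso: "semimodule_isomorphic S M (generated_subsemimodule S (vec_semimodule S n) n u)"
    and fixed: "\<And>i. i \<in> {1..n} \<Longrightarrow> lin_comb S (vec_semimodule S n) n u (u i) = u i"
  shows "projective S M"
  unfolding projective_def lifts_along_def
proof (intro allI impI ballI)
  fix M' :: "('a, 'b \<Rightarrow> 'a) module" and N' :: "('a, 'b) module" and g f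
  assume M': "semimodule S M'" and N': "semimodule S N'"
    and g: "g \<in> semimodule_hom S M' N'" and f: "f \<in> semimodule_hom S M N'"
    and surj: "g ` carrier M' = carrier N'"
  interpret M: semimodule S M by fact
  let ?V = "vec_semimodule S n"
  interpret V: semimodule S ?V
    by (rule semimodule_vec_semimodule) (rule M.S.semiring_axioms)
  obtain \<phi> where \<phi>: "\<phi> \<in> semimodule_hom S M (generated_subsemimodule S ?V n u)"
      and bij: "bij_betw \<phi> (carrier M) (span_family S ?V n u)"
    using iso by (auto simp: semimodule_isomorphic_def generated_subsemimodule_def)
  have span_V: "span_family S ?V n u \<subseteq> carrier ?V"
    by (rule V.span_family_closed(1)[OF u])
  have \<phi>V: "\<phi> \<in> semimodule_hom S M ?V"
    using \<phi> span_V by (auto simp: semimodule_hom_def generated_subsemimodule_def)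
  have "\<forall>i\<in>{1..n}. \<exists>w\<in>carrier M. \<phi> w = u i"
    using span_family_generator[OF V.semimodule_axioms u] bij
    unfolding bij_betw_def by (metis imageE)
  then obtain w where w: "w \<in> {1..n} \<rightarrow> carrier M" "\<And>i. i \<in> {1..n} \<Longrightarrow> \<phi> (w i) = u i"
    by (metis Pi_I)
  have "\<forall>i\<in>{1..n}. \<exists>t\<in>carrier M'. g t = f (w i)"
    using w(1) semimodule_homD(1)[OF f] surj by (metis imageE Pi_mem)
  then obtain t where t: "t \<in> {1..n} \<rightarrow> carrier M'" "\<And>i. i \<in> {1..n} \<Longrightarrow> g (t i) = f (w i)"
    by (metis Pi_I)
  show "\<exists>f'\<in>semimodule_hom S M M'. \<forall>y\<in>carrier M. g (f' y) = f y"
  proof (rule bexI[of _ "\<lambda>y. lin_comb S M' n t (\<phi> y)"])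
    show "(\<lambda>y. lin_comb S M' n t (\<phi> y)) \<in> semimodule_hom S M M'"
      using \<phi>V lin_comb_hom[OF M' t(1)] by (auto simp: semimodule_hom_def Pi_iff)
    show "\<forall>y\<in>carrier M. g (lin_comb S M' n t (\<phi> y)) = f y"
    proof
      fix y assume y: "y \<in> carrier M"
      have c: "\<phi> y \<in> {1..n} \<rightarrow> carrier S"
        using vec_carrierD[OF semimodule_homD(1)[OF \<phi>V y]] by auto
      have fw: "(\<lambda>i. f (w i)) \<in> {1..n} \<rightarrow> carrier N'"
        using w(1) semimodule_homD(1)[OF f] by auto
      \<comment> \<open>both sides have the same image under the injective \<open>\<phi>\<close>, namely \<open>\<phi> y\<close>\<close>
      have y_eq: "lin_comb S M n w (\<phi> y) = y"
      proof (rule inj_onD[OF bij_betw_imp_inj_on[OF bij]])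
        have "\<phi> (lin_comb S M n w (\<phi> y)) = lin_comb S ?V n (\<lambda>i. \<phi> (w i)) (\<phi> y)"
          by (rule hom_lin_comb[OF assms(1) V.semimodule_axioms \<phi>V w(1) c])
        also have "\<dots> = lin_comb S ?V n u (\<phi> y)"
          using w(2) c by (intro lin_comb_cong[OF V.semimodule_axioms u]) auto
        also have "\<dots> = \<phi> y"
          using bij_betwE[OF bij] y
          by (intro rows_fixed_imp_span_fixed[OF M.S.semiring_axioms u fixed]) auto
        finally show "\<phi> (lin_comb S M n w (\<phi> y)) = \<phi> y" .
        show "lin_comb S M n w (\<phi> y) \<in> carrier M"
          by (rule semimodule_homD(1)[OF lin_comb_hom[OF assms(1) w(1)]
                semimodule_homD(1)[OF \<phi>V y]])
      qed (rule y)
      have "g (lin_comb S M' n t (\<phi> y)) = lin_comb S N' n (\<lambda>i. g (t i)) (\<phi> y)"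
        by (rule hom_lin_comb[OF M' N' g t(1) c])
      also have "\<dots> = lin_comb S N' n (\<lambda>i. f (w i)) (\<phi> y)"
        using t(2) c by (intro lin_comb_cong[OF N' fw]) auto
      also have "\<dots> = f (lin_comb S M n w (\<phi> y))"
        by (rule hom_lin_comb[OF assms(1) N' f w(1) c, symmetric])
      also have "\<dots> = f y"
        by (simp only: y_eq)
      finally show "g (lin_comb S M' n t (\<phi> y)) = f y" .
    qed
  qed
qed

theorem theorem3p3:
  fixes S :: "('a, 'r) ring_scheme" and n :: nat and M :: "('a, 'b, 'm) module_scheme"
  assumes "semiring S" and "n > 0" and "semimodule S M" and "n_generated S n M"
  shows "projective S M \<longleftrightarrow>
    (\<exists>u. (\<forall>i\<in>{1..n}. u i \<in> carrier (vec_semimodule S n)) \<and>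
         semimodule_isomorphic S M (generated_subsemimodule S (vec_semimodule S n) n u) \<and>
         (let U = (\<lambda>i\<in>{1..n}. \<lambda>j\<in>{1..n}. u i j)
          in U \<in> carrier (mat_semiring S n) \<and> U \<otimes>\<^bsub>mat_semiring S n\<^esub> U = U))"
    (is "_ \<longleftrightarrow> ?idempotent_presentation")
proof
  assume "projective S M"
  then obtain u where u: "u \<in> {1..n} \<rightarrow> carrier (vec_semimodule S n)"
      "semimodule_isomorphic S M (generated_subsemimodule S (vec_semimodule S n) n u)"
      "\<And>i. i \<in> {1..n} \<Longrightarrow> lin_comb S (vec_semimodule S n) n u (u i) = u i"
    using projective_imp_idempotent[OF assms(3,4)] by blast
  show ?idempotent_presentation
    unfolding Let_def
  proof (intro exI[of _ u] conjI)
    show "\<forall>i\<in>{1..n}. u i \<in> carrier (vec_semimodule S n)"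
      using u(1) by auto
  qed (use u idempotent_iff_rows_fixed[OF assms(1) u(1)] in simp_all)
next
  assume ?idempotent_presentation
  then obtain u where u: "u \<in> {1..n} \<rightarrow> carrier (vec_semimodule S n)"
      and iso: "semimodule_isomorphic S M (generated_subsemimodule S (vec_semimodule S n) n u)"
      and idem: "(\<lambda>i\<in>{1..n}. \<lambda>j\<in>{1..n}. u i j) \<otimes>\<^bsub>mat_semiring S n\<^esub>
        (\<lambda>i\<in>{1..n}. \<lambda>j\<in>{1..n}. u i j) = (\<lambda>i\<in>{1..n}. \<lambda>j\<in>{1..n}. u i j)"
    unfolding Let_def by blast
  have "\<And>i. i \<in> {1..n} \<Longrightarrow> lin_comb S (vec_semimodule S n) n u (u i) = u i"
    using idempotent_iff_rows_fixed(2)[OF assms(1) u] idem by simp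
  then show "projective S M"
    by (rule idempotent_imp_projective[OF assms(3) u iso])
qed

end
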